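(* Let $k,n$ be positive integers, $G\subseteq S_k$ a subgroup and $x\in B_{\mathbf{1}_G}(k,n)$. In coordinates $(z_y)_{y\in B_{\mathbf{1}_G}(k,n)}$ with respect to the basis $\{P^{(n)}_{\mathbf{1}_G}(e_y)\}$ of $V^{\otimes k}_{\mathbf{1}_G}$, the set $\mathbb{P}(V_{x^\downarrow})\cap\mathrm{Gr}_{\mathbf{1}_G}(k,n)$ is described by the parametric equations $$z_y=|G_y|^{-1}(\mathbf{1}_G)_{y,(1,\dots,k)}(A^x)\ \text{ for } y\in x^\downarrow,\qquad z_y=0\ \text{ for } y\notin x^\downarrow,$$ with parameters $a_{ij}\in\mathbb{C}$ ($i\in[n]$, $j\in[k]$).
   Context: $V=\mathbb{C}^n$ with basis $e_1,\dots,e_n$, $e_x=e_{x_1}\otimes\cdots\otimes e_{x_k}$; $S_k$ acts on $[n]^k$ by $w(x)=(x_{w^{-1}(1)},\dots,x_{w^{-1}(k)})$ and on $V^{\otimes k}$ by $w(e_x)=e_{w(x)}$, inducing $P\mapsto P^{(n)}$. $P_{\mathbf{1}_G}=\frac1{|G|}\sum_{g\in G}g$, $V^{\otimes k}_{\mathbf{1}_G}=\mathrm{Im}(P^{(n)}_{\mathbf{1}_G})$, $\mathrm{Gr}_{\mathbf{1}_G}(k,n)=\{[P^{(n)}_{\mathbf{1}_G}(v_1\otimes\cdots\otimes v_k)]:v_i\in V\setminus\{0\}\}$. $G_y=\{g\in G:g(y)=y\}$; $\overline y$ is the lexicographic minimum of $\{g(y):g\in G\}$; $B_{\mathbf{1}_G}(k,n)=\{\overline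 y:y\in[n]^k\}$ ordered by $y\preccurlyeq y'$ iff $y\leqslant g(y')$ componentwise for some $g\in G$; $x^\downarrow=\{y\in B_{\mathbf{1}_G}(k,n):y\preccurlyeq x\}$; the vectors $P^{(n)}_{\mathbf{1}_G}(e_y)$, $y\in B_{\mathbf{1}_G}(k,n)$, form a basis of $V^{\otimes k}_{\mathbf{1}_G}$, and $V_{x^\downarrow}$ is the span of those with $y\in x^\downarrow$. $A^x\in\mathrm{Mat}_{n,k}(\mathbb{C})$ has entries $A^x_{i,j}=a_{ij}$ if $i\leqslant x_j$ and $0$ otherwise. For $M\in\mathrm{Mat}_{n,k}(\mathbb{C})$, $(M^{\otimes k})_{u,w}=\prod_{i=1}^kM_{u_i,w_i}$ and $(\mathbf{1}_G)_{y,(1,\dots,k)}(M)=\sum_{g\in G}(M^{\otimes k})_{g(y),(1,\dots,k)}$. *)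

theory Defs
  imports "HOL-Analysis.Analysis" "HOL-Algebra.Bij" "HOL-Library.Fun_Lexorder"
begin

text \<open>
  The index sets \<open>[k]\<close> and \<open>[n]\<close> are finite linearly ordered types \<open>'k\<close> and \<open>'n\<close> (up to a unique
  order isomorphism these are exactly the sets \<open>{1,\<dots>,k}\<close>, \<open>{1,\<dots>,n}\<close> with \<open>k, n \<ge> 1\<close>).
  Thus \<open>V\<close> is \<^typ>\<open>complex ^ 'n\<close>, the set \<open>[n]\<^sup>k\<close> is the type \<^typ>\<open>'k \<Rightarrow> 'n\<close>, and the \<open>k\<close>-th tensor
  power of \<open>V\<close> is the coordinate space \<^typ>\<open>complex ^ ('k \<Rightarrow> 'n)\<close> in which \<open>e\<^sub>x\<close> is the standard
  unit vector at \<open>x\<close>. The symmetric group \<open>S\<^sub>k\<close> is \<^term>\<open>BijGroup (UNIV :: 'k set)\<close>.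
\<close>

type_synonym ('k, 'n) tensor = "complex ^ ('k \<Rightarrow> 'n)"

definition basis_tensor :: "('k::finite \<Rightarrow> 'n::finite) \<Rightarrow> ('k, 'n) tensor" where
  "basis_tensor x = axis x 1"

text \<open>The coordinates of \<open>v\<^sub>1 \<otimes> \<dots> \<otimes> v\<^sub>k\<close> are given by multilinear expansion.\<close>

definition pure_tensor :: "('k::finite \<Rightarrow> complex ^ 'n::finite) \<Rightarrow> ('k, 'n) tensor" where
  "pure_tensor v = (\<Sum>x\<in>UNIV. (\<Prod>j\<in>UNIV. v j $ x j) *s basis_tensor x)"

definition tuple_act :: "('k \<Rightarrow> 'k) \<Rightarrow> ('k \<Rightarrow> 'n) \<Rightarrow> ('k \<Rightarrow> 'n)" where
  "tuple_act w x = (\<lambda>j. x (inv_into UNIV w j))"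

definition tensor_act ::
  "('k \<Rightarrow> 'k) \<Rightarrow> ('k::finite, 'n::finite) tensor \<Rightarrow> ('k, 'n) tensor" where
  "tensor_act w T = (\<Sum>x\<in>UNIV. (T $ x) *s basis_tensor (tuple_act w x))"

text \<open>
  An element \<open>P\<close> of the group algebra of \<open>S\<^sub>k\<close> is given by its coefficient function;
  \<open>alg_act P\<close> is the operator \<open>P\<^bsup>(n)\<^esup>\<close>.
\<close>

definition alg_act ::
  "(('k \<Rightarrow> 'k) \<Rightarrow> complex) \<Rightarrow> ('k::finite, 'n::finite) tensor \<Rightarrow> ('k, 'n) tensor" where
  "alg_act P T = (\<Sum>w\<in>Bij UNIV. P w *s tensor_act w T)"

definition triv_idem :: "('k \<Rightarrow> 'k) set \<Rightarrow> ('k \<Rightarrow> 'k) \<Rightarrow> complex" where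
  "triv_idem G w = (if w \<in> G then 1 / of_nat (card G) else 0)"

definition sym_space :: "('k \<Rightarrow> 'k) set \<Rightarrow> ('k::finite, 'n::finite) tensor set" where
  "sym_space G = range (alg_act (triv_idem G))"

text \<open>Points of projective space are one-dimensional subspaces.\<close>

definition proj_point :: "complex ^ 'a::finite \<Rightarrow> (complex ^ 'a) set" where
  "proj_point v = vec.span {v}"

definition projectivization :: "(complex ^ 'a::finite) set \<Rightarrow> (complex ^ 'a) set set" where
  "projectivization W = {proj_point v |v. v \<in> W \<and> v \<noteq> 0}"

text \<open>
  For a subgroup \<open>G\<close> of \<open>S\<^sub>k\<close>, the symmetrization of a tensor product of nonzero vectors is never zero,
  so the elements of \<open>Gr_triv G\<close> are indeed projective points.
\<close>

definition Gr_triv :: "('k \<Rightarrow> 'k) set \<Rightarrow> ('k::finite, 'n::finite) tensor set set" where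
  "Gr_triv G = {proj_point (alg_act (triv_idem G) (pure_tensor v)) |v. \<forall>j. v j \<noteq> 0}"

definition stabilizer :: "('k \<Rightarrow> 'k) set \<Rightarrow> ('k \<Rightarrow> 'n) \<Rightarrow> ('k \<Rightarrow> 'k) set" where
  "stabilizer G y = {g \<in> G. tuple_act g y = y}"

definition orbit :: "('k \<Rightarrow> 'k) set \<Rightarrow> ('k \<Rightarrow> 'n) \<Rightarrow> ('k \<Rightarrow> 'n) set" where
  "orbit G y = {tuple_act g y |g. g \<in> G}"

definition lex_min_rep ::
  "('k::linorder \<Rightarrow> 'k) set \<Rightarrow> ('k \<Rightarrow> 'n::linorder) \<Rightarrow> ('k \<Rightarrow> 'n)" where
  "lex_min_rep G y = (THE m. m \<in> orbit G y \<and> (\<forall>z\<in>orbit G y. m = z \<or> less_fun m z))"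

definition B_triv :: "('k::linorder \<Rightarrow> 'k) set \<Rightarrow> ('k \<Rightarrow> 'n::linorder) set" where
  "B_triv G = range (lex_min_rep G)"

text \<open>The order \<open>\<le>\<close> on \<^typ>\<open>'k \<Rightarrow> 'n\<close> is the componentwise one.\<close>

definition prec :: "('k \<Rightarrow> 'k) set \<Rightarrow> ('k \<Rightarrow> 'n::linorder) \<Rightarrow> ('k \<Rightarrow> 'n) \<Rightarrow> bool" where
  "prec G y y' \<longleftrightarrow> (\<exists>g\<in>G. y \<le> tuple_act g y')"

definition down_set ::
  "('k::linorder \<Rightarrow> 'k) set \<Rightarrow> ('k \<Rightarrow> 'n::linorder) \<Rightarrow> ('k \<Rightarrow> 'n) set" where
  "down_set G x = {y \<in> B_triv G. prec G y x}"

definition basis_vec :: "('k \<Rightarrow> 'k) set \<Rightarrow> ('k::finite \<Rightarrow> 'n::finite) \<Rightarrow> ('k, 'n) tensor" where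
  "basis_vec G y = alg_act (triv_idem G) (basis_tensor y)"

text \<open>
  For a subgroup \<open>G\<close> of \<open>S\<^sub>k\<close>, \<open>basis_vec G\<close> is injective on \<open>B_triv G\<close> and its image is a basis of
  \<open>sym_space G\<close>, so the library's \<open>representation\<close> yields the coordinates indexed by \<open>B_triv G\<close>.
\<close>

definition coord ::
  "('k \<Rightarrow> 'k) set \<Rightarrow> ('k::{finite,linorder}, 'n::{finite,linorder}) tensor \<Rightarrow> ('k \<Rightarrow> 'n) \<Rightarrow> complex"
  where "coord G T y = vec.representation (basis_vec G ` B_triv G) T (basis_vec G y)"

definition V_down ::
  "('k \<Rightarrow> 'k) set \<Rightarrow> ('k::{finite,linorder} \<Rightarrow> 'n::{finite,linorder}) \<Rightarrow> ('k, 'n) tensor set" where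
  "V_down G x = vec.span (basis_vec G ` down_set G x)"

text \<open>Matrices with \<open>n\<close> rows and \<open>k\<close> columns have type \<^typ>\<open>complex ^ 'k ^ 'n\<close>.\<close>

definition trunc_matrix ::
  "complex ^ 'k ^ ('n::{finite,linorder}) \<Rightarrow> ('k \<Rightarrow> 'n)
    \<Rightarrow> complex ^ 'k ^ ('n::{finite,linorder})" where
  "trunc_matrix A x = (\<chi> i j. if i \<le> x j then A $ i $ j else 0)"

definition tensor_power_entry ::
  "complex ^ 'k::finite ^ 'n::finite \<Rightarrow> ('k \<Rightarrow> 'n) \<Rightarrow> ('k \<Rightarrow> 'k) \<Rightarrow> complex" where
  "tensor_power_entry M u w = (\<Prod>i\<in>UNIV. M $ u i $ w i)"

text \<open>The tuple \<open>(1,\<dots>,k)\<close> is the identity function.\<close>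

definition triv_immanant ::
  "('k \<Rightarrow> 'k) set \<Rightarrow> ('k \<Rightarrow> 'n) \<Rightarrow> complex ^ 'k::finite ^ 'n::finite \<Rightarrow> complex" where
  "triv_immanant G y M = (\<Sum>g\<in>G. tensor_power_entry M (tuple_act g y) id)"

end

theory Submission
  imports Defs
begin

text \<open>
  The coordinate of a \<open>G\<close>-invariant tensor \<open>T\<close> at \<open>y\<close> is \<open>(|G| / |G\<^sub>y|) T\<^sub>y\<close>, so the symmetrization
  of \<open>v\<^sub>1 \<otimes> \<dots> \<otimes> v\<^sub>k\<close> has coordinates \<open>|G\<^sub>y|\<^sup>-\<^sup>1 (\<one>\<^sub>G)\<^sub>y(M)\<close>, where \<open>M\<close> has columns \<open>v\<^sub>j\<close>. If \<open>M\<close> is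
  truncated by \<open>x\<close>, the coordinates outside \<open>x\<^sup>\<down>\<close> vanish, because \<open>g(y) \<le> x\<close> forces \<open>y \<preceq> x\<close>.
  Conversely, let \<open>m\<^sub>j\<close> be the largest index in the support of \<open>v\<^sub>j\<close>. The only rearrangement of \<open>m\<close>
  that is componentwise below \<open>m\<close> is \<open>m\<close> itself, so the symmetrization is nonzero at \<open>m\<close>. If it lies
  in \<open>V\<close> of \<open>x\<^sup>\<down>\<close>, then \<open>m \<le> h(x)\<close> for some \<open>h \<in> G\<close>, and permuting the \<open>v\<^sub>j\<close> by \<open>h\<close>, which does not
  change the symmetrization, makes the matrix equal to its truncation by \<open>x\<close>.
\<close>

section \<open>Lexicographic minima and the action on tuples\<close>

lemma finite_less_fun_minimum:
  fixes S :: "('k::{finite,linorder} \<Rightarrow> 'n::linorder) set"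
  assumes "finite S" "S \<noteq> {}"
  shows "\<exists>m\<in>S. \<forall>z\<in>S. m = z \<or> less_fun m z"
  using assms
proof (induction rule: finite_ne_induct)
  case (insert a S)
  then obtain m where m: "m \<in> S" "\<forall>z\<in>S. m = z \<or> less_fun m z" by blast
  have "less_fun a m \<or> a = m \<or> less_fun m a"
    by (rule less_fun_trichotomy) simp
  then show ?case
  proof (elim disjE)
    assume "less_fun a m"
    then have "\<forall>z\<in>insert a S. a = z \<or> less_fun a z" using m less_fun_trans[of a m] by auto
    then show ?thesis by blast
  qed (use m in auto)
qed simp

lemma tuple_act_id [simp]: "tuple_act id y = y"
  by (simp add: tuple_act_def)

lemma tuple_act_comp:
  "bij g \<Longrightarrow> bij h \<Longrightarrow> tuple_act (g \<circ> h) y = tuple_act g (tuple_act h y)"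
  by (simp add: tuple_act_def o_inv_distrib)

lemma tuple_act_eq_iff: "bij w \<Longrightarrow> tuple_act w x = u \<longleftrightarrow> x = u \<circ> w"
  unfolding tuple_act_def fun_eq_iff o_def
  by (metis bij_is_inj bij_is_surj inv_f_f surj_f_inv_f)

lemma tuple_act_le_iff: "bij w \<Longrightarrow> u \<le> tuple_act w x \<longleftrightarrow> u \<circ> w \<le> x"
  unfolding le_fun_def tuple_act_def o_def
  by (metis bij_is_inj bij_is_surj inv_f_f surj_f_inv_f)

lemma tuple_act_inv: "bij w \<Longrightarrow> tuple_act (inv_into UNIV w) u = u \<circ> w"
  by (simp add: tuple_act_def inv_inv_eq o_def)

text \<open>A rearrangement preserves the sum of the ranks of the entries, whereas a componentwise
  decrease that is strict somewhere would lower it.\<close>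

lemma tuple_act_le_self:
  fixes m :: "'k::finite \<Rightarrow> 'n::{finite,linorder}"
  assumes "bij g" "tuple_act g m \<le> m"
  shows "tuple_act g m = m"
proof (rule ccontr)
  assume ne: "tuple_act g m \<noteq> m"
  \<comment> \<open>The type \<open>'n\<close> has only an order; counting the smaller elements
    embeds it strictly monotonically into the naturals, where entries can be summed.\<close>
  define r :: "'n \<Rightarrow> nat" where "r i = card {..<i}" for i
  have r_less: "r i < r j" if "i < j" for i j
    unfolding r_def using that by (intro psubset_card_mono) auto
  have r_le: "r i \<le> r j" if "i \<le> j" for i j
    using r_less[of i j] that by (cases "i = j") (auto simp: le_less)
  obtain j where "tuple_act g m j \<noteq> m j" using ne by auto
  then have "tuple_act g m j < m j" using assms(2) by (simp add: le_fun_def less_le)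
  then have "(\<Sum>j\<in>UNIV. r (tuple_act g m j)) < (\<Sum>j\<in>UNIV. r (m j))"
    using assms(2) by (intro sum_strict_mono_ex1) (auto simp: le_fun_def intro: r_le r_less)
  moreover have "(\<Sum>j\<in>UNIV. r (tuple_act g m j)) = (\<Sum>j\<in>UNIV. r (m j))"
    unfolding tuple_act_def
    by (rule sum.reindex_bij_betw) (simp add: assms(1) bij_imp_bij_inv)
  ultimately show False by simp
qed

section \<open>Entries of tensors\<close>

lemma tensor_act_nth: "bij w \<Longrightarrow> tensor_act w T $ u = T $ (u \<circ> w)"
  by (simp add: tensor_act_def basis_tensor_def axis_def tuple_act_eq_iff eq_commute[of u]
      if_distrib [of "\<lambda>c. _ * c"] cong: if_cong)

lemma pure_tensor_nth: "pure_tensor v $ u = (\<Prod>j\<in>UNIV. v j $ u j)"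
  by (simp add: pure_tensor_def basis_tensor_def axis_def
      if_distrib [of "\<lambda>c. _ * c"] cong: if_cong)

lemma pure_tensor_permute:
  assumes "bij w"
  shows "pure_tensor (v \<circ> w) $ u = pure_tensor v $ tuple_act w u"
proof -
  have "(\<Prod>j\<in>UNIV. v (w j) $ u j) = (\<Prod>j\<in>UNIV. v (w j) $ tuple_act w u (w j))"
    using assms by (simp add: tuple_act_def bij_is_inj)
  also have "\<dots> = (\<Prod>i\<in>UNIV. v i $ tuple_act w u i)"
    by (rule prod.reindex_bij_betw) (rule assms)
  finally show ?thesis by (simp add: pure_tensor_nth)
qed

section \<open>Subgroups of the symmetric group, with the group operations as plain composition and
  inverse functions\<close>

locale permutation_subgroup =
  fixes G :: "('k::{finite,linorder} \<Rightarrow> 'k) set"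
  assumes subgroup: "subgroup G (BijGroup UNIV)"
begin

lemma subset_Bij: "G \<subseteq> Bij UNIV"
  using subgroup.subset[OF subgroup] by (simp add: BijGroup_def)

lemma bij_mem: "g \<in> G \<Longrightarrow> bij g"
  using subset_Bij by (auto simp: Bij_def)

lemma id_mem: "id \<in> G"
  using subgroup.one_closed[OF subgroup] by (simp add: BijGroup_def id_def restrict_UNIV)

lemma comp_mem:
  assumes "g \<in> G" "h \<in> G"
  shows "g \<circ> h \<in> G"
proof -
  have "g \<in> Bij UNIV" "h \<in> Bij UNIV" using assms subset_Bij by auto
  then have "g \<otimes>\<^bsub>BijGroup UNIV\<^esub> h = g \<circ> h"
    by (simp add: BijGroup_def compose_def comp_def restrict_UNIV)
  then show ?thesis using subgroup.m_closed[OF subgroup assms] by simp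
qed

lemma inv_mem:
  assumes "g \<in> G"
  shows "inv_into UNIV g \<in> G"
proof -
  have "g \<in> Bij UNIV" using assms subset_Bij by auto
  then have "inv\<^bsub>BijGroup UNIV\<^esub> g = inv_into UNIV g"
    by (simp add: inv_BijGroup restrict_UNIV)
  then show ?thesis using subgroup.m_inv_closed[OF subgroup assms] by simp
qed

lemma nonempty: "G \<noteq> {}"
  using id_mem by auto

lemma bij_betw_comp: "h \<in> G \<Longrightarrow> bij_betw (\<lambda>g. h \<circ> g) G G"
  by (rule bij_betw_byWitness[where f' = "\<lambda>g. inv_into UNIV h \<circ> g"])
    (auto simp: comp_mem inv_mem o_assoc bij_mem bij_is_inj bij_is_surj surj_iff[THEN iffD1])

lemma bij_betw_comp_right: "h \<in> G \<Longrightarrow> bij_betw (\<lambda>g. g \<circ> h) G G"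
  by (rule bij_betw_byWitness[where f' = "\<lambda>g. g \<circ> inv_into UNIV h"])
    (auto simp: comp_mem inv_mem bij_mem bij_is_inj bij_is_surj comp_assoc surj_iff[THEN iffD1])

lemma bij_betw_inv_mem: "bij_betw (inv_into UNIV) G G"
  by (rule bij_betw_byWitness[where f' = "inv_into UNIV"]) (auto simp: inv_mem inv_inv_eq bij_mem)

lemma act_comp: "g \<in> G \<Longrightarrow> h \<in> G \<Longrightarrow> tuple_act (g \<circ> h) y = tuple_act g (tuple_act h y)"
  by (simp add: tuple_act_comp bij_mem)

lemma act_inv_act [simp]: "g \<in> G \<Longrightarrow> tuple_act (inv_into UNIV g) (tuple_act g y) = y"
  by (simp add: tuple_act_def inv_inv_eq bij_mem bij_is_inj)

section \<open>Orbits and their lexicographic representatives\<close>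

lemma mem_orbit_self: "y \<in> orbit G y"
  unfolding orbit_def using id_mem tuple_act_id by (metis (mono_tags, lifting) mem_Collect_eq)

lemma orbit_tuple_act:
  assumes "g \<in> G"
  shows "orbit G (tuple_act g y) = orbit G y"
proof -
  have sub: "orbit G (tuple_act h z) \<subseteq> orbit G z" if "h \<in> G" for h and z :: "'k \<Rightarrow> 'a"
    using that by (auto simp: orbit_def simp flip: act_comp) (blast intro: comp_mem)
  \<comment> \<open>The reverse inclusion is the same one applied to the inverse of \<open>g\<close>
    and the tuple \<open>tuple_act g y\<close>.\<close>
  show ?thesis
    using sub[OF assms, of y] sub[OF inv_mem[OF assms], of "tuple_act g y"] assms by auto
qed

lemma orbit_eq: "z \<in> orbit G y \<Longrightarrow> orbit G z = orbit G y"
proof -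
  assume "z \<in> orbit G y"
  then obtain g where "g \<in> G" "z = tuple_act g y" unfolding orbit_def by blast
  then show ?thesis by (simp add: orbit_tuple_act)
qed

lemma lex_min_rep_mem_orbit:
  fixes y :: "'k \<Rightarrow> 'n::{finite,linorder}"
  shows "lex_min_rep G y \<in> orbit G y"
proof -
  obtain m where m: "m \<in> orbit G y" "\<forall>z\<in>orbit G y. m = z \<or> less_fun m z"
    using finite_less_fun_minimum[of "orbit G y"] mem_orbit_self[of y] by auto
  have "lex_min_rep G y = m"
    unfolding lex_min_rep_def
  proof (rule the_equality)
    fix m' assume "m' \<in> orbit G y \<and> (\<forall>z\<in>orbit G y. m' = z \<or> less_fun m' z)"
    then show "m' = m" using m less_fun_asym[of m m'] by metis
  qed (use m in auto)
  with m show ?thesis by simp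
qed

lemma orbit_meets_B_triv:
  fixes u :: "'k \<Rightarrow> 'n::{finite,linorder}"
  obtains g where "g \<in> G" "tuple_act g u \<in> B_triv G"
proof -
  obtain g where "g \<in> G" "lex_min_rep G u = tuple_act g u"
    using lex_min_rep_mem_orbit[of u] by (auto simp: orbit_def)
  with that[of g] show ?thesis by (metis B_triv_def rangeI)
qed

text \<open>The value \<open>lex_min_rep G z\<close> depends on \<open>z\<close> only through its
  orbit, so \<open>B_triv G\<close> has just one element in each orbit.\<close>

lemma B_triv_unique:
  fixes y y' :: "'k \<Rightarrow> 'n::{finite,linorder}"
  assumes "y \<in> B_triv G" "y' \<in> B_triv G" "y' \<in> orbit G y"
  shows "y' = y"
proof -
  obtain z z' where z: "y = lex_min_rep G z" "y' = lex_min_rep G z'"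
    using assms(1,2) unfolding B_triv_def by blast
  have "orbit G y = orbit G z" "orbit G y' = orbit G z'"
    unfolding z by (rule orbit_eq[OF lex_min_rep_mem_orbit])+
  then have "orbit G z' = orbit G z" using orbit_eq[OF assms(3)] by simp
  then show ?thesis unfolding z lex_min_rep_def by simp
qed

lemma stabilizer_nonempty: "stabilizer G y \<noteq> {}"
  using id_mem tuple_act_id unfolding stabilizer_def by blast

section \<open>Symmetrization and invariant tensors\<close>

lemma symmetrize_nth:
  "alg_act (triv_idem G) T $ u = (\<Sum>g\<in>G. T $ tuple_act g u) / of_nat (card G)"
proof -
  have "alg_act (triv_idem G) T $ u
      = (\<Sum>w\<in>Bij UNIV. if w \<in> G then T $ (u \<circ> w) / of_nat (card G) else 0)"
    unfolding alg_act_def sum_component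
    by (rule sum.cong) (auto simp: triv_idem_def tensor_act_nth bij_mem)
  also have "\<dots> = (\<Sum>w\<in>G. T $ (u \<circ> w) / of_nat (card G))"
    using subset_Bij by (intro sum.mono_neutral_cong_right) auto
  \<comment> \<open>The entry at \<open>u\<close> is pulled back by the inverse of \<open>w\<close>;
    as inversion permutes \<open>G\<close>, the sum can be taken over \<open>G\<close> without
    inverses.\<close>
  also have "\<dots> = (\<Sum>w\<in>G. T $ tuple_act (inv_into UNIV w) u / of_nat (card G))"
    by (simp add: tuple_act_inv bij_mem)
  also have "\<dots> = (\<Sum>g\<in>G. T $ tuple_act g u / of_nat (card G))"
    by (rule sum.reindex_bij_betw[OF bij_betw_inv_mem])
  finally show ?thesis by (simp add: sum_divide_distrib)
qed

lemma sym_space_invariant: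
  assumes "T \<in> sym_space G" "g \<in> G"
  shows "T $ tuple_act g u = T $ u"
proof -
  obtain S where S: "T = alg_act (triv_idem G) S"
    using assms(1) by (auto simp: sym_space_def)
  have "(\<Sum>h\<in>G. S $ tuple_act h (tuple_act g u)) = (\<Sum>h\<in>G. S $ tuple_act (h \<circ> g) u)"
    using assms(2) by (simp add: act_comp)
  also have "\<dots> = (\<Sum>h\<in>G. S $ tuple_act h u)"
    by (rule sum.reindex_bij_betw[OF bij_betw_comp_right[OF assms(2)]])
  finally show ?thesis by (simp add: S symmetrize_nth)
qed

text \<open>Permuting the factors by \<open>h\<close> amounts to a left translation of the summation
  index, which permutes \<open>G\<close>.\<close>

lemma symmetrize_pure_tensor_permute:
  assumes "h \<in> G"
  shows "alg_act (triv_idem G) (pure_tensor (v \<circ> h)) = alg_act (triv_idem G) (pure_tensor v)"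
proof (subst vec_eq_iff, rule allI)
  fix u
  have "(\<Sum>g\<in>G. pure_tensor (v \<circ> h) $ tuple_act g u) = (\<Sum>g\<in>G. pure_tensor v $ tuple_act (h \<circ> g) u)"
    using assms by (simp add: pure_tensor_permute bij_mem act_comp)
  also have "\<dots> = (\<Sum>g\<in>G. pure_tensor v $ tuple_act g u)"
    by (rule sum.reindex_bij_betw[OF bij_betw_comp[OF assms]])
  finally show "alg_act (triv_idem G) (pure_tensor (v \<circ> h)) $ u = alg_act (triv_idem G) (pure_tensor v) $ u"
    by (simp add: symmetrize_nth)
qed

lemma symmetrize_pure_tensor_columns_nth:
  "alg_act (triv_idem G) (pure_tensor (\<lambda>j. column j A)) $ y = triv_immanant G y A / of_nat (card G)"
  by (simp add: symmetrize_nth pure_tensor_nth triv_immanant_def tensor_power_entry_def column_def)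

section \<open>The basis of symmetrized unit vectors and its coordinates\<close>

lemma basis_vec_nth_off_orbit: "y \<notin> orbit G u \<Longrightarrow> basis_vec G y $ u = 0"
  by (auto simp: basis_vec_def symmetrize_nth basis_tensor_def axis_def orbit_def
      intro!: sum.neutral split: if_splits)

text \<open>Exactly the elements of the stabilizer contribute. This entry is the source of the
  factor \<open>inverse (of_nat (card (stabilizer G y)))\<close> in the parametric
  equations.\<close>

lemma basis_vec_nth_self: "basis_vec G y $ y = of_nat (card (stabilizer G y)) / of_nat (card G)"
proof -
  have "(\<Sum>g\<in>G. basis_tensor y $ tuple_act g y) = (\<Sum>g\<in>G. if tuple_act g y = y then 1 else 0)"
    by (simp add: basis_tensor_def axis_def eq_commute)
  also have "\<dots> = of_nat (card (stabilizer G y))"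
    by (simp add: stabilizer_def flip: sum.inter_filter)
  finally show ?thesis by (simp add: basis_vec_def symmetrize_nth)
qed

lemma basis_vec_nth_self_nonzero: "basis_vec G y $ y \<noteq> 0"
  using nonempty stabilizer_nonempty[of y] by (simp add: basis_vec_nth_self)

lemma basis_vec_nth_B_triv:
  fixes y y' :: "'k \<Rightarrow> 'n::{finite,linorder}"
  assumes "y \<in> B_triv G" "y' \<in> B_triv G" "y' \<noteq> y"
  shows "basis_vec G y' $ y = 0"
  using B_triv_unique[OF assms(1,2)] assms(3) basis_vec_nth_off_orbit by blast

text \<open>Distinct representatives have disjoint orbits, so evaluation at representatives is
  diagonal on the vectors \<open>basis_vec G y\<close>. Both independence and the coordinate formula
  rest on this.\<close>

lemma basis_vec_combination_nth:
  fixes y :: "'k \<Rightarrow> 'n::{finite,linorder}"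
  assumes "y \<in> B_triv G"
  shows "(\<Sum>y'\<in>B_triv G. c y' *s basis_vec G y') $ y = c y * basis_vec G y $ y"
proof -
  have "(\<Sum>y'\<in>B_triv G. c y' *s basis_vec G y') $ y = (\<Sum>y'\<in>B_triv G. c y' * basis_vec G y' $ y)"
    by simp
  also have "\<dots> = (\<Sum>y'\<in>{y}. c y' * basis_vec G y' $ y)"
    using assms basis_vec_nth_B_triv[OF assms] by (intro sum.mono_neutral_right) auto
  finally show ?thesis by simp
qed

lemma inj_on_basis_vec: "inj_on (basis_vec G) (B_triv G :: ('k \<Rightarrow> 'n::{finite,linorder}) set)"
  by (rule inj_onI) (metis basis_vec_nth_B_triv basis_vec_nth_self_nonzero)

lemma independent_basis_vec:
  "vec.independent (basis_vec G ` (B_triv G :: ('k \<Rightarrow> 'n::{finite,linorder}) set))"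
proof (rule vec.independent_if_scalars_zero)
  fix f :: "('k, 'n) tensor \<Rightarrow> complex" and b :: "('k, 'n) tensor"
  assume 0: "(\<Sum>b\<in>basis_vec G ` B_triv G. f b *s b) = 0" and "b \<in> basis_vec G ` B_triv G"
  then obtain y where y: "y \<in> B_triv G" "b = basis_vec G y" by blast
  have "(\<Sum>y'\<in>B_triv G. f (basis_vec G y') *s basis_vec G y') = 0"
    using 0 by (simp add: sum.reindex[OF inj_on_basis_vec])
  then have "f b * basis_vec G y $ y = 0"
    using basis_vec_combination_nth[OF y(1), of "\<lambda>y'. f (basis_vec G y')"] y by simp
  then show "f b = 0" using basis_vec_nth_self_nonzero[of y] by simp
qed simp

lemma basis_vec_in_sym_space: "basis_vec G y \<in> sym_space G"
  by (simp add: basis_vec_def sym_space_def)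

text \<open>Invariant tensors are constant on orbits, and every orbit meets
  \<open>B_triv G\<close>.\<close>

lemma sym_space_eqI:
  fixes T S :: "('k, 'n::{finite,linorder}) tensor"
  assumes "T \<in> sym_space G" "S \<in> sym_space G" "\<And>y. y \<in> B_triv G \<Longrightarrow> T $ y = S $ y"
  shows "T = S"
proof (subst vec_eq_iff, rule allI)
  fix u :: "'k \<Rightarrow> 'n"
  obtain g where "g \<in> G" "tuple_act g u \<in> B_triv G" by (rule orbit_meets_B_triv[of u])
  then show "T $ u = S $ u"
    using assms(3)[of "tuple_act g u"] sym_space_invariant[OF assms(1)] sym_space_invariant[OF assms(2)]
    by simp
qed

lemma subspace_sym_space: "vec.subspace (sym_space G :: ('k, 'n::finite) tensor set)"
proof -
  have "Vector_Spaces.linear (*s) (*s) (alg_act (triv_idem G) :: ('k, 'n) tensor \<Rightarrow> _)"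
    by unfold_locales
      (simp_all add: vec_eq_iff symmetrize_nth sum.distrib sum_distrib_left add_divide_distrib algebra_simps)
  then show ?thesis
    unfolding sym_space_def by (rule vec.linear_subspace_image[OF _ vec.subspace_UNIV])
qed

lemma sym_space_expansion:
  fixes T :: "('k, 'n::{finite,linorder}) tensor"
  assumes "T \<in> sym_space G"
  shows "T = (\<Sum>y\<in>B_triv G. (T $ y / basis_vec G y $ y) *s basis_vec G y)"
proof (rule sym_space_eqI[OF assms])
  show "(\<Sum>y\<in>B_triv G. (T $ y / basis_vec G y $ y) *s basis_vec G y) \<in> sym_space G"
    by (intro vec.subspace_sum vec.subspace_scale subspace_sym_space basis_vec_in_sym_space)
qed (simp only: basis_vec_combination_nth, simp add: basis_vec_nth_self_nonzero)

lemma coord_eq: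
  fixes T :: "('k, 'n::{finite,linorder}) tensor"
  assumes "T \<in> sym_space G" "y \<in> B_triv G"
  shows "coord G T y = T $ y * of_nat (card G) / of_nat (card (stabilizer G y))"
proof -
  let ?b = "basis_vec G ` (B_triv G :: ('k \<Rightarrow> 'n) set)"
  have "T \<in> vec.span ?b"
    by (subst sym_space_expansion[OF assms(1)])
      (rule vec.span_sum, rule vec.span_scale, rule vec.span_base, simp)
  then have "(\<Sum>b\<in>?b. vec.representation ?b T b *s b) = T"
    by (intro vec.sum_representation_eq independent_basis_vec) auto
  \<comment> \<open>Injectivity of \<open>basis_vec G\<close> lets the basis be indexed by
    \<open>B_triv G\<close>, after which evaluation at \<open>y\<close> isolates one
    coordinate.\<close>
  then have "(\<Sum>y'\<in>B_triv G. coord G T y' *s basis_vec G y') = T"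
    by (simp add: sum.reindex[OF inj_on_basis_vec] coord_def)
  then have "T $ y = coord G T y * basis_vec G y $ y"
    using basis_vec_combination_nth[OF assms(2), of "coord G T"] by simp
  then show ?thesis
    using nonempty stabilizer_nonempty[of y] by (simp add: basis_vec_nth_self)
qed

section \<open>The subspace of a down set\<close>

lemma V_down_iff:
  fixes T :: "('k, 'n::{finite,linorder}) tensor"
  assumes "T \<in> sym_space G"
  shows "T \<in> V_down G x \<longleftrightarrow> (\<forall>y\<in>B_triv G - down_set G x. T $ y = 0)"
proof
  assume T: "T \<in> V_down G x"
  show "\<forall>y\<in>B_triv G - down_set G x. T $ y = 0"
  proof
    fix y assume y: "y \<in> B_triv G - down_set G x"
    \<comment> \<open>The tensors vanishing at \<open>y\<close> form a subspace containing all
      generators of \<open>V_down G x\<close>.\<close>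
    have "vec.subspace {S :: ('k, 'n) tensor. S $ y = 0}"
      by (auto simp: vec.subspace_def)
    moreover have "basis_vec G ` down_set G x \<subseteq> {S. S $ y = 0}"
      using y basis_vec_nth_B_triv[of y] by (auto simp: down_set_def)
    ultimately show "T $ y = 0"
      using T vec.span_minimal unfolding V_down_def by blast
  qed
next
  assume "\<forall>y\<in>B_triv G - down_set G x. T $ y = 0"
  then have "T = (\<Sum>y\<in>down_set G x. (T $ y / basis_vec G y $ y) *s basis_vec G y)"
    by (subst sym_space_expansion[OF assms], intro sum.mono_neutral_right)
      (auto simp: down_set_def)
  then show "T \<in> V_down G x"
    unfolding V_down_def by (rule ssubst) (rule vec.span_sum, rule vec.span_scale, rule vec.span_base, simp)
qed

section \<open>Truncated matrices and leading indices\<close>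

lemma triv_immanant_trunc_matrix_off_down_set:
  assumes "y \<in> B_triv G - down_set G x"
  shows "triv_immanant G y (trunc_matrix A x) = 0"
  unfolding triv_immanant_def
proof (rule sum.neutral, rule ballI)
  fix g assume g: "g \<in> G"
  \<comment> \<open>A nonzero product for \<open>g\<close> would require
    \<open>tuple_act g y \<le> x\<close>; moving \<open>g\<close> to the other side would then
    witness \<open>prec G y x\<close>.\<close>
  have "\<not> y \<le> tuple_act (inv_into UNIV g) x"
    using assms inv_mem[OF g] by (auto simp: down_set_def prec_def)
  then have "\<not> tuple_act g y \<le> x"
    using tuple_act_le_iff[of "inv_into UNIV g" y x] g
    by (simp add: bij_mem bij_imp_bij_inv tuple_act_def o_def)
  then show "tensor_power_entry (trunc_matrix A x) (tuple_act g y) id = 0"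
    by (auto simp: tensor_power_entry_def trunc_matrix_def le_fun_def)
qed

text \<open>All surviving terms of the sum over \<open>G\<close> equal the same nonzero product of
  leading entries, so nothing can cancel.\<close>

lemma symmetrize_pure_tensor_top_nonzero:
  fixes v :: "'k \<Rightarrow> complex ^ 'n::{finite,linorder}"
  assumes "\<And>j. v j $ m j \<noteq> 0" "\<And>i j. v j $ i \<noteq> 0 \<Longrightarrow> i \<le> m j"
  shows "alg_act (triv_idem G) (pure_tensor v) $ m \<noteq> 0"
proof -
  have "pure_tensor v $ tuple_act g m = (if tuple_act g m = m then \<Prod>j\<in>UNIV. v j $ m j else 0)"
    if "g \<in> G" for g
  proof (cases "tuple_act g m = m")
    case False
    then have "\<not> tuple_act g m \<le> m" using tuple_act_le_self bij_mem[OF that] by blast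
    then show ?thesis using False assms(2) by (auto simp: pure_tensor_nth le_fun_def)
  qed (simp add: pure_tensor_nth)
  then have "(\<Sum>g\<in>G. pure_tensor v $ tuple_act g m)
      = of_nat (card (stabilizer G m)) * (\<Prod>j\<in>UNIV. v j $ m j)"
    by (simp add: stabilizer_def flip: sum.inter_filter)
  then show ?thesis
    using nonempty stabilizer_nonempty[of m] assms(1) by (simp add: symmetrize_nth)
qed

lemma pure_tensor_in_V_down_truncated:
  fixes v :: "'k \<Rightarrow> complex ^ 'n::{finite,linorder}"
  assumes "\<And>j. v j \<noteq> 0" "alg_act (triv_idem G) (pure_tensor v) \<in> V_down G x"
  obtains A where "alg_act (triv_idem G) (pure_tensor v)
    = alg_act (triv_idem G) (pure_tensor (\<lambda>j. column j (trunc_matrix A x)))"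
proof -
  define T where "T = alg_act (triv_idem G) (pure_tensor v)"
  have T: "T \<in> sym_space G" by (simp add: T_def sym_space_def)
  define m where "m j = Max {i. v j $ i \<noteq> 0}" for j
  have "{i. v j $ i \<noteq> 0} \<noteq> {}" for j using assms(1)[of j] by (auto simp: vec_eq_iff)
  then have m: "v j $ m j \<noteq> 0" for j
    using Max_in[of "{i. v j $ i \<noteq> 0}"] by (auto simp: m_def)
  have m_max: "i \<le> m j" if "v j $ i \<noteq> 0" for i j
    using that by (simp add: m_def)
  have "T $ m \<noteq> 0"
    unfolding T_def using m m_max by (rule symmetrize_pure_tensor_top_nonzero)
  \<comment> \<open>Since \<open>down_set G x\<close> contains representatives only,
    \<open>m\<close> is first moved to the representative of its orbit.\<close>
  obtain g where g: "g \<in> G" "tuple_act g m \<in> B_triv G" by (rule orbit_meets_B_triv[of m])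
  have "T $ tuple_act g m \<noteq> 0"
    using \<open>T $ m \<noteq> 0\<close> sym_space_invariant[OF T g(1)] by simp
  then have "tuple_act g m \<in> down_set G x"
    using assms(2) V_down_iff[OF T] g(2) by (auto simp: T_def)
  then obtain h where h: "h \<in> G" "tuple_act g m \<le> tuple_act h x"
    by (auto simp: down_set_def prec_def)
  \<comment> \<open>Chosen so that \<open>tuple_act g m \<le> tuple_act h x\<close> becomes
    \<open>m \<circ> f \<le> x\<close>; the columns of the matrix will be the vectors
    \<open>v (f j)\<close>, whose entries beyond \<open>x j\<close> vanish.\<close>
  define f where "f = inv_into UNIV g \<circ> h"
  have f: "f \<in> G" using g h by (simp add: f_def comp_mem inv_mem)
  have le: "m (f j) \<le> x j" for j
    using h g by (simp add: tuple_act_le_iff bij_mem) (simp add: le_fun_def tuple_act_def f_def)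
  define A where "A = (\<chi> i j. v (f j) $ i)"
  have "trunc_matrix A x = A"
    using m_max le by (auto simp: trunc_matrix_def A_def vec_eq_iff) (meson order_trans)
  then have "(\<lambda>j. column j (trunc_matrix A x)) = v \<circ> f"
    by (simp add: A_def column_def fun_eq_iff vec_eq_iff)
  then show ?thesis
    using that[of A] symmetrize_pure_tensor_permute[OF f, of v] by simp
qed

section \<open>Parametric equations\<close>

lemma coord_symmetrize_columns:
  fixes A :: "complex ^ ('k::{finite,linorder}) ^ ('n::{finite,linorder})"
  assumes "y \<in> B_triv G"
  shows "coord G (alg_act (triv_idem G) (pure_tensor (\<lambda>j. column j A))) y
    = inverse (of_nat (card (stabilizer G y))) * triv_immanant G y A"
proof -
  have "alg_act (triv_idem G) (pure_tensor (\<lambda>j. column j A)) \<in> sym_space G"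
    by (simp add: sym_space_def)
  then show ?thesis
    using nonempty
    by (simp add: coord_eq assms symmetrize_pure_tensor_columns_nth field_simps)
qed

text \<open>Coordinates determine an element of \<open>sym_space G\<close>, and the right-hand sides
  are the coordinates of the symmetrized truncated columns. The zero equations fit because the
  immanant vanishes off the down set.\<close>

lemma parametric_equations_iff:
  fixes T :: "('k, 'n::{finite,linorder}) tensor"
  assumes "T \<in> sym_space G"
  shows "(\<forall>y\<in>down_set G x.
        coord G T y = inverse (of_nat (card (stabilizer G y))) * triv_immanant G y (trunc_matrix A x)) \<and>
      (\<forall>y\<in>B_triv G - down_set G x. coord G T y = 0)
    \<longleftrightarrow> T = alg_act (triv_idem G) (pure_tensor (\<lambda>j. column j (trunc_matrix A x)))"
    (is "?L \<longleftrightarrow> T = ?S")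
proof
  assume ?L
  have S: "?S \<in> sym_space G" by (simp add: sym_space_def)
  have c: "coord G T y = coord G ?S y" if "y \<in> B_triv G" for y
    using \<open>?L\<close> that coord_symmetrize_columns[OF that, of "trunc_matrix A x"]
      triv_immanant_trunc_matrix_off_down_set[of y x A]
    by (cases "y \<in> down_set G x") auto
  show "T = ?S"
  proof (rule sym_space_eqI[OF assms S])
    fix y :: "'k \<Rightarrow> 'n" assume "y \<in> B_triv G"
    then show "T $ y = ?S $ y"
      using c[of y] nonempty stabilizer_nonempty[of y] coord_eq[OF assms, of y] coord_eq[OF S, of y]
      by simp
  qed
next
  assume "T = ?S"
  then show ?L
    using triv_immanant_trunc_matrix_off_down_set[of _ x A]
    by (auto simp: coord_symmetrize_columns down_set_def)
qed

end

theorem theorem6p2: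
  fixes G :: "('k::{finite,linorder} \<Rightarrow> 'k) set"
    and x :: "'k \<Rightarrow> 'n::{finite,linorder}"
  assumes "subgroup G (BijGroup UNIV)"
    and "x \<in> B_triv G"
  shows "projectivization (V_down G x) \<inter> Gr_triv G =
    {proj_point T |T. T \<in> sym_space G \<and> T \<noteq> 0 \<and>
      (\<exists>A :: complex ^ ('k::{finite,linorder}) ^ ('n::{finite,linorder}).
        (\<forall>y\<in>down_set G x.
          coord G T y = inverse (of_nat (card (stabilizer G y))) * triv_immanant G y (trunc_matrix A x)) \<and>
        (\<forall>y\<in>B_triv G - down_set G x. coord G T y = 0))}"
    (is "?L = ?R")
proof -
  interpret permutation_subgroup G by (rule permutation_subgroup.intro) (rule assms(1))
  let ?S = "\<lambda>v :: 'k \<Rightarrow> complex ^ 'n::{finite,linorder}. alg_act (triv_idem G) (pure_tensor v)"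
  have "?R = {proj_point T |T. T \<in> sym_space G \<and> T \<noteq> 0 \<and>
      (\<exists>A. T = ?S (\<lambda>j. column j (trunc_matrix A x)))}"
    by (intro Collect_cong ex_cong1 conj_cong refl) (rule parametric_equations_iff)
  also have "?L = \<dots>"
  proof (intro subset_antisym subsetI)
    fix p assume "p \<in> ?L"
    then obtain w v where w: "w \<in> V_down G x" "w \<noteq> 0" "p = proj_point w"
      and v: "\<forall>j. v j \<noteq> 0" "p = proj_point (?S v)"
      by (auto simp: projectivization_def Gr_triv_def)
    \<comment> \<open>The representatives \<open>w\<close> and \<open>?S v\<close> of
      \<open>p\<close> may differ by a scalar, so membership in \<open>V_down G x\<close> and
      nonvanishing pass from one to the other through their common span.\<close>
    have eq: "vec.span {w} = vec.span {?S v}"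
      using w v by (simp add: proj_point_def)
    have "?S v \<in> vec.span {w}" unfolding eq by (simp add: vec.span_base)
    also have "\<dots> \<subseteq> V_down G x"
      using w(1) unfolding V_down_def by (intro vec.span_minimal) auto
    finally have V: "?S v \<in> V_down G x" .
    have "?S v \<noteq> 0"
    proof
      assume "?S v = 0"
      then have "w \<in> vec.span {0}" using eq vec.span_base[of w "{w}"] by simp
      then show False using w(2) by simp
    qed
    obtain A where "?S v = ?S (\<lambda>j. column j (trunc_matrix A x))"
      using v(1) V by (metis pure_tensor_in_V_down_truncated)
    moreover have "?S v \<in> sym_space G" by (simp add: sym_space_def)
    ultimately show "p \<in> {proj_point T |T. T \<in> sym_space G \<and> T \<noteq> 0 \<and>
      (\<exists>A. T = ?S (\<lambda>j. column j (trunc_matrix A x)))}"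
      using v(2) \<open>?S v \<noteq> 0\<close> by blast
  next
    fix p assume "p \<in> {proj_point T |T. T \<in> sym_space G \<and> T \<noteq> 0 \<and>
      (\<exists>A. T = ?S (\<lambda>j. column j (trunc_matrix A x)))}"
    then obtain T A where T: "p = proj_point T" "T \<in> sym_space G" "T \<noteq> 0"
      and A: "T = ?S (\<lambda>j. column j (trunc_matrix A x))" by blast
    have "T \<in> V_down G x"
      using triv_immanant_trunc_matrix_off_down_set[of _ x A]
      unfolding V_down_iff[OF T(2)] by (auto simp: A symmetrize_pure_tensor_columns_nth)
    \<comment> \<open>Membership in \<open>Gr_triv G\<close> asks for nonzero factors; a zero column
      would make the whole tensor vanish, against \<open>T \<noteq> 0\<close>.\<close>
    moreover have "column j (trunc_matrix A x) \<noteq> 0" for j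
    proof
      assume "column j (trunc_matrix A x) = 0"
      then have "pure_tensor (\<lambda>j. column j (trunc_matrix A x)) $ u = 0" for u
        unfolding pure_tensor_nth by (intro prod_zero bexI[of _ j]) auto
      then show False using T(3) by (simp add: A vec_eq_iff symmetrize_nth)
    qed
    ultimately show "p \<in> ?L"
      using T A unfolding projectivization_def Gr_triv_def by blast
  qed
  finally show ?thesis by simp
qed

end
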